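(* Let $F:A\times B\to Z$ be a single-valued mapping. (i) If $F$ is partially Gâteaux differentiable on $A\times B$ with respect to each variable, then $$\mathrm{SOVI}_1(F;A,B)\subseteq\partial_1^CF\quad\text{and}\quad \mathrm{SOVI}_2(F;A,B)\subseteq\partial_2^CF.$$ (ii) If $F$ is partially Fréchet differentiable on $A\times B$ with respect to each variable, then $$\mathrm{SOVI}_1(F;A,B)\subseteq\nabla_1^CF\quad\text{and}\quad \mathrm{SOVI}_2(F;A,B)\subseteq\nabla_2^CF.$$
   Context: $(X,\|\cdot\|_X)$, $(Y,\|\cdot\|_Y)$ are Banach spaces and $(Z,\|\cdot\|_Z,\preccurlyeq_M)$ is a partially ordered Banach space whose order is generated by a nonempty closed convex pointed cone $M\subseteq Z$ ($z_1\preccurlyeq_Mz_2$ iff $z_2-z_1\in M$); null elements are $\theta_X,\theta_Y,\theta_Z$. $A\subseteq X$, $B\subseteq Y$ are nonempty convex open subsets. $\mathrm{SOVI}_1(F;A,B)$ is the set of solutions of the ordered variational inequality problem with respect to the first variable, i.e. of all $(\bar x,\bar y)\in A\times B$ with $F(\bar x,\bar y)\preccurlyeq_MF(x,\bar y)$ for every $x\in A$; $\mathrm{SOVI}_2(F;A,B)$ is the set of all $(\bar x,\bar y)\in A\times B$ with $F(\bar x,\bar y)\preccurlyeq_MF(\bar x,y)$ for every $y\in B$. Partial Gâteaux differentiability at $(\bar x,\bar y)$ with respect to the first (second) variable means that $\partial_1F(\bar x,\bar y)(v)=\lim_{t\to0}\frac{F(\bar x+tv,\bar y)-F(\bar x,\bar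 y)}{t}$ exists for every $v\in X\setminus\{\theta_X\}$ ($\partial_2F(\bar x,\bar y)(u)=\lim_{t\to0}\frac{F(\bar x,\bar y+tu)-F(\bar x,\bar y)}{t}$ exists for every $u\in Y\setminus\{\theta_Y\}$), $t$ real. Partial Fréchet differentiability means that there is a continuous linear $\nabla_1F(\bar x,\bar y):X\to Z$ with $\lim_{u\to\theta_X}\frac{F(\bar x+u,\bar y)-F(\bar x,\bar y)-\nabla_1F(\bar x,\bar y)(u)}{\|u\|_X}=\theta_Z$ (a continuous linear $\nabla_2F(\bar x,\bar y):Y\to Z$ with $\lim_{w\to\theta_Y}\frac{F(\bar x,\bar y+w)-F(\bar x,\bar y)-\nabla_2F(\bar x,\bar y)(w)}{\|w\|_Y}=\theta_Z$). $\partial_1^CF$ (resp. $\partial_2^CF$) is the set of $(\bar x,\bar y)\in A\times B$ with $\partial_1F(\bar x,\bar y)(v)=\theta_Z$ for all $v\in X\setminus\{\theta_X\}$ (resp. $\partial_2F(\bar x,\bar y)(u)=\theta_Z$ for all $u\in Y\setminus\{\theta_Y\}$). $\nabla_1^CF$ (resp. $\nabla_2^CF$) is the set of $(\bar x,\bar y)\in A\times B$ at which $\nabla_1F(\bar x,\bar y)$ (resp. $\nabla_2F(\bar x,\bar y)$) is the zero mapping. *)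

theory Defs
  imports "HOL-Analysis.Analysis"
begin

definition cone_le :: "'z::real_vector set \<Rightarrow> 'z \<Rightarrow> 'z \<Rightarrow> bool" where
  "cone_le M z1 z2 \<longleftrightarrow> z2 - z1 \<in> M"

(* A mapping F : A \<times> B \<rightarrow> Z is represented by a total function on 'x \<times> 'y.  Its values
   outside A \<times> B are never used: the solution sets only evaluate F on A \<times> B, and the
   derivatives are taken at points of A \<times> B with A and B open, so the limits see only
   values of F on A \<times> B. *)

definition SOVI1 ::
  "'z::real_vector set \<Rightarrow> ('x \<times> 'y \<Rightarrow> 'z) \<Rightarrow> 'x set \<Rightarrow> 'y set \<Rightarrow> ('x \<times> 'y) set" where
  "SOVI1 M F A B = {(x0, y0) \<in> A \<times> B. \<forall>x\<in>A. cone_le M (F (x0, y0)) (F (x, y0))}"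

definition SOVI2 ::
  "'z::real_vector set \<Rightarrow> ('x \<times> 'y \<Rightarrow> 'z) \<Rightarrow> 'x set \<Rightarrow> 'y set \<Rightarrow> ('x \<times> 'y) set" where
  "SOVI2 M F A B = {(x0, y0) \<in> A \<times> B. \<forall>y\<in>B. cone_le M (F (x0, y0)) (F (x0, y))}"

definition gateaux_quot1 ::
  "('x::real_normed_vector \<times> 'y \<Rightarrow> 'z::real_normed_vector) \<Rightarrow> 'x \<times> 'y \<Rightarrow> 'x \<Rightarrow> real \<Rightarrow> 'z" where
  "gateaux_quot1 F = (\<lambda>(x0, y0) v t. (F (x0 + t *\<^sub>R v, y0) - F (x0, y0)) /\<^sub>R t)"

definition gateaux_quot2 ::
  "('x \<times> 'y::real_normed_vector \<Rightarrow> 'z::real_normed_vector) \<Rightarrow> 'x \<times> 'y \<Rightarrow> 'y \<Rightarrow> real \<Rightarrow> 'z" where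
  "gateaux_quot2 F = (\<lambda>(x0, y0) u t. (F (x0, y0 + t *\<^sub>R u) - F (x0, y0)) /\<^sub>R t)"

(* The existence of the directional limits only; linearity or continuity in the direction
   is not part of the notion. *)

definition gateaux_differentiable1 ::
  "('x::real_normed_vector \<times> 'y \<Rightarrow> 'z::real_normed_vector) \<Rightarrow> 'x \<times> 'y \<Rightarrow> bool" where
  "gateaux_differentiable1 F p \<longleftrightarrow> (\<forall>v. v \<noteq> 0 \<longrightarrow> (\<exists>d. (gateaux_quot1 F p v \<longlongrightarrow> d) (at 0)))"

definition gateaux_differentiable2 ::
  "('x \<times> 'y::real_normed_vector \<Rightarrow> 'z::real_normed_vector) \<Rightarrow> 'x \<times> 'y \<Rightarrow> bool" where
  "gateaux_differentiable2 F p \<longleftrightarrow> (\<forall>u. u \<noteq> 0 \<longrightarrow> (\<exists>d. (gateaux_quot2 F p u \<longlongrightarrow> d) (at 0)))"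

definition gateaux_deriv1 ::
  "('x::real_normed_vector \<times> 'y \<Rightarrow> 'z::real_normed_vector) \<Rightarrow> 'x \<times> 'y \<Rightarrow> 'x \<Rightarrow> 'z" where
  "gateaux_deriv1 F p v = Lim (at 0) (gateaux_quot1 F p v)"

definition gateaux_deriv2 ::
  "('x \<times> 'y::real_normed_vector \<Rightarrow> 'z::real_normed_vector) \<Rightarrow> 'x \<times> 'y \<Rightarrow> 'y \<Rightarrow> 'z" where
  "gateaux_deriv2 F p u = Lim (at 0) (gateaux_quot2 F p u)"

(* Lim is an arbitrary value when the limit does not exist, so existence is demanded
   explicitly in the critical sets; likewise for the Frechet versions below. *)

definition gateaux_critical1 ::
  "('x::real_normed_vector \<times> 'y \<Rightarrow> 'z::real_normed_vector) \<Rightarrow> 'x set \<Rightarrow> 'y set \<Rightarrow> ('x \<times> 'y) set" where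
  "gateaux_critical1 F A B =
     {p \<in> A \<times> B. gateaux_differentiable1 F p \<and> (\<forall>v. v \<noteq> 0 \<longrightarrow> gateaux_deriv1 F p v = 0)}"

definition gateaux_critical2 ::
  "('x \<times> 'y::real_normed_vector \<Rightarrow> 'z::real_normed_vector) \<Rightarrow> 'x set \<Rightarrow> 'y set \<Rightarrow> ('x \<times> 'y) set" where
  "gateaux_critical2 F A B =
     {p \<in> A \<times> B. gateaux_differentiable2 F p \<and> (\<forall>u. u \<noteq> 0 \<longrightarrow> gateaux_deriv2 F p u = 0)}"

definition frechet_differentiable1 ::
  "('x::real_normed_vector \<times> 'y \<Rightarrow> 'z::real_normed_vector) \<Rightarrow> 'x \<times> 'y \<Rightarrow> bool" where
  "frechet_differentiable1 F = (\<lambda>(x0, y0). (\<lambda>x. F (x, y0)) differentiable (at x0))"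

definition frechet_differentiable2 ::
  "('x \<times> 'y::real_normed_vector \<Rightarrow> 'z::real_normed_vector) \<Rightarrow> 'x \<times> 'y \<Rightarrow> bool" where
  "frechet_differentiable2 F = (\<lambda>(x0, y0). (\<lambda>y. F (x0, y)) differentiable (at y0))"

definition frechet_deriv1 ::
  "('x::real_normed_vector \<times> 'y \<Rightarrow> 'z::real_normed_vector) \<Rightarrow> 'x \<times> 'y \<Rightarrow> 'x \<Rightarrow> 'z" where
  "frechet_deriv1 F = (\<lambda>(x0, y0). frechet_derivative (\<lambda>x. F (x, y0)) (at x0))"

definition frechet_deriv2 ::
  "('x \<times> 'y::real_normed_vector \<Rightarrow> 'z::real_normed_vector) \<Rightarrow> 'x \<times> 'y \<Rightarrow> 'y \<Rightarrow> 'z" where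
  "frechet_deriv2 F = (\<lambda>(x0, y0). frechet_derivative (\<lambda>y. F (x0, y)) (at y0))"

definition frechet_critical1 ::
  "('x::real_normed_vector \<times> 'y \<Rightarrow> 'z::real_normed_vector) \<Rightarrow> 'x set \<Rightarrow> 'y set \<Rightarrow> ('x \<times> 'y) set" where
  "frechet_critical1 F A B =
     {p \<in> A \<times> B. frechet_differentiable1 F p \<and> frechet_deriv1 F p = (\<lambda>_. 0)}"

definition frechet_critical2 ::
  "('x \<times> 'y::real_normed_vector \<Rightarrow> 'z::real_normed_vector) \<Rightarrow> 'x set \<Rightarrow> 'y set \<Rightarrow> ('x \<times> 'y) set" where
  "frechet_critical2 F A B =
     {p \<in> A \<times> B. frechet_differentiable2 F p \<and> frechet_deriv2 F p = (\<lambda>_. 0)}"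

end

theory Submission
  imports Defs
begin

text \<open>
  Freezing one of the two variables turns both inclusions into the vector-valued Fermat rule.
  If \<open>g a\<close> is a least value of \<open>g\<close> on an open set with respect to the order of a cone \<open>M\<close>, then
  the difference quotients of \<open>g\<close> at \<open>a\<close> lie in \<open>M\<close> for small positive steps and in \<open>-M\<close> for
  small negative steps. As \<open>M\<close> is closed, a two-sided limit of these quotients lies in
  \<open>M \<inter> -M\<close>, which is trivial for a pointed cone (\<open>directional_derivative_at_cone_minimum\<close>).
  The Frechet case reduces to this one, because a Frechet derivative is evaluated by
  directional limits (\<open>frechet_derivative_at_cone_minimum\<close>).
\<close>

text \<open>
  The increment \<open>g (a + t *\<^sub>R v) - g a\<close> lies in \<open>M\<close> for all small \<open>t\<close> of either sign, so dividing
  by \<open>t\<close> puts the right-hand limit into \<open>M\<close> and the left-hand limit into \<open>-M\<close>.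
\<close>
lemma directional_derivative_at_cone_minimum:
  fixes g :: "'x::real_normed_vector \<Rightarrow> 'z::real_normed_vector"
  assumes "closed M" "cone M" and pointed: "M \<inter> uminus ` M = {0}"
    and "open A" "a \<in> A" and min: "\<forall>x\<in>A. cone_le M (g a) (g x)"
    and lim: "((\<lambda>t. (g (a + t *\<^sub>R v) - g a) /\<^sub>R t) \<longlongrightarrow> d) (at (0::real))"
  shows "d = 0"
proof -
  let ?q = "\<lambda>t::real. (g (a + t *\<^sub>R v) - g a) /\<^sub>R t"
  have "((\<lambda>t. a + t *\<^sub>R v) \<longlongrightarrow> a + 0 *\<^sub>R v) (at (0::real))"
    by (intro tendsto_intros)
  then have "\<forall>\<^sub>F t in at (0::real). a + t *\<^sub>R v \<in> A"
    using topological_tendstoD[OF _ \<open>open A\<close>] \<open>a \<in> A\<close> by auto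
  then have inc: "\<forall>\<^sub>F t in at (0::real). g (a + t *\<^sub>R v) - g a \<in> M"
    by eventually_elim (use min in \<open>auto simp: cone_le_def\<close>)
  have "d \<in> M"
  proof (rule Lim_in_closed_set[OF \<open>closed M\<close>])
    have "\<forall>\<^sub>F t in at_right (0::real). g (a + t *\<^sub>R v) - g a \<in> M"
      using inc by (simp add: eventually_at_split)
    moreover have "\<forall>\<^sub>F t in at_right (0::real). 0 < t"
      by (simp add: eventually_at_right_less)
    ultimately show "\<forall>\<^sub>F t in at_right 0. ?q t \<in> M"
      by eventually_elim (use \<open>cone M\<close> in \<open>simp add: cone_def\<close>)
    show "(?q \<longlongrightarrow> d) (at_right 0)"
      using lim by (simp add: filterlim_at_split)
  qed simp
  moreover have "- d \<in> M"
  proof (rule Lim_in_closed_set[OF \<open>closed M\<close>])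
    have "\<forall>\<^sub>F t in at_left (0::real). g (a + t *\<^sub>R v) - g a \<in> M"
      using inc by (simp add: eventually_at_split)
    moreover have "\<forall>\<^sub>F t in at_left (0::real). t < 0"
      by (auto simp: eventually_at_filter)
    ultimately show "\<forall>\<^sub>F t in at_left 0. - ?q t \<in> M"
    proof eventually_elim
      case (elim t)
      then have "(- inverse t) *\<^sub>R (g (a + t *\<^sub>R v) - g a) \<in> M"
        using \<open>cone M\<close> unfolding cone_def
          by (metis inverse_nonpositive_iff_nonpositive less_imp_le neg_0_le_iff_le)
      then show ?case
        by (simp only: scaleR_minus_left)
    qed
    show "((\<lambda>t. - ?q t) \<longlongrightarrow> - d) (at_left 0)"
      using lim by (intro tendsto_minus) (simp add: filterlim_at_split)
  qed simp
  ultimately show ?thesis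
    using pointed by force
qed

text \<open>
  Along the line \<open>t \<mapsto> a + t *\<^sub>R v\<close>, the chain rule gives the derivative \<open>t \<mapsto> t *\<^sub>R D v\<close>. Its
  normalised remainder has the same norm as the difference quotient minus \<open>D v\<close>.
\<close>
lemma has_derivative_imp_directional_limit:
  fixes g :: "'x::real_normed_vector \<Rightarrow> 'z::real_normed_vector"
  assumes "(g has_derivative D) (at a)"
  shows "((\<lambda>t. (g (a + t *\<^sub>R v) - g a) /\<^sub>R t) \<longlongrightarrow> D v) (at (0::real))"
proof -
  interpret bounded_linear D
    using assms by (rule has_derivative_bounded_linear)
  have "((\<lambda>t. g (a + t *\<^sub>R v)) has_derivative (\<lambda>t. D (t *\<^sub>R v))) (at (0::real))"
    by (rule has_derivative_compose[of "\<lambda>t. a + t *\<^sub>R v"])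
      (use assms in \<open>auto intro!: derivative_eq_intros\<close>)
  then have "((\<lambda>t. norm (g (a + t *\<^sub>R v) - g a - t *\<^sub>R D v) / norm t) \<longlongrightarrow> 0) (at 0)"
    unfolding has_derivative_iff_norm by (simp add: scaleR)
  moreover have "\<forall>\<^sub>F t in at (0::real). norm (g (a + t *\<^sub>R v) - g a - t *\<^sub>R D v) / norm t
      = norm ((g (a + t *\<^sub>R v) - g a) /\<^sub>R t - D v)"
    unfolding eventually_at_filter
  proof (intro always_eventually allI impI)
    fix t :: real assume "t \<noteq> 0"
    then have "(g (a + t *\<^sub>R v) - g a) /\<^sub>R t - D v
        = (g (a + t *\<^sub>R v) - g a - t *\<^sub>R D v) /\<^sub>R t"
      by (simp add: scaleR_diff_right)
    then show "norm (g (a + t *\<^sub>R v) - g a - t *\<^sub>R D v) / norm t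
        = norm ((g (a + t *\<^sub>R v) - g a) /\<^sub>R t - D v)"
      by (simp add: divide_inverse_commute)
  qed
  ultimately have "((\<lambda>t. norm ((g (a + t *\<^sub>R v) - g a) /\<^sub>R t - D v)) \<longlongrightarrow> 0) (at 0)"
    by (rule Lim_transform_eventually)
  then show ?thesis
    by (rule LIM_zero_cancel[OF tendsto_norm_zero_cancel])
qed

lemma frechet_derivative_at_cone_minimum:
  fixes g :: "'x::real_normed_vector \<Rightarrow> 'z::real_normed_vector"
  assumes "closed M" "cone M" "M \<inter> uminus ` M = {0}"
    and "open A" "a \<in> A" "\<forall>x\<in>A. cone_le M (g a) (g x)"
    and "g differentiable (at a)"
  shows "frechet_derivative g (at a) = (\<lambda>_. 0)"
proof
  fix v
  have "(g has_derivative frechet_derivative g (at a)) (at a)"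
    using assms(7) by (simp add: frechet_derivative_works)
  note lim = has_derivative_imp_directional_limit[OF this, of v]
  show "frechet_derivative g (at a) v = 0"
    using lim by (rule directional_derivative_at_cone_minimum[OF assms(1-6)])
qed

theorem proposition7p3:
  fixes A :: "'x::banach set" and B :: "'y::banach set"
    and M :: "'z::banach set" and F :: "'x \<times> 'y \<Rightarrow> 'z"
  assumes "M \<noteq> {}" and "closed M" and "convex M" and "cone M"
    and pointed: "M \<inter> uminus ` M = {0}"
    and "A \<noteq> {}" and "convex A" and "open A"
    and "B \<noteq> {}" and "convex B" and "open B"
  shows "((\<forall>p\<in>A \<times> B. gateaux_differentiable1 F p \<and> gateaux_differentiable2 F p) \<longrightarrow>
            SOVI1 M F A B \<subseteq> gateaux_critical1 F A B \<and>
            SOVI2 M F A B \<subseteq> gateaux_critical2 F A B) \<and>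
         ((\<forall>p\<in>A \<times> B. frechet_differentiable1 F p \<and> frechet_differentiable2 F p) \<longrightarrow>
            SOVI1 M F A B \<subseteq> frechet_critical1 F A B \<and>
            SOVI2 M F A B \<subseteq> frechet_critical2 F A B)"
proof -
  note cone = \<open>closed M\<close> \<open>cone M\<close> pointed
  have "SOVI1 M F A B \<subseteq> gateaux_critical1 F A B"
    if diff: "\<forall>p\<in>A \<times> B. gateaux_differentiable1 F p \<and> gateaux_differentiable2 F p"
  proof clarify
    fix x y
    assume sol: "(x, y) \<in> SOVI1 M F A B"
    then have p: "(x, y) \<in> A \<times> B"
      by (auto simp: SOVI1_def)
    have "(gateaux_quot1 F (x, y) v \<longlongrightarrow> 0) (at 0)" if "v \<noteq> 0" for v
    proof -
      obtain d where d: "(gateaux_quot1 F (x, y) v \<longlongrightarrow> d) (at 0)"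
        using bspec[OF diff p] \<open>v \<noteq> 0\<close> unfolding gateaux_differentiable1_def by blast
      moreover have "d = 0"
        by (rule directional_derivative_at_cone_minimum
              [OF cone \<open>open A\<close>, of x "\<lambda>x. F (x, y)" v])
          (use sol d in \<open>auto simp: SOVI1_def gateaux_quot1_def\<close>)
      ultimately show ?thesis by simp
    qed
    then show "(x, y) \<in> gateaux_critical1 F A B"
      using bspec[OF diff p] p
      by (auto simp: gateaux_critical1_def gateaux_deriv1_def intro!: tendsto_Lim)
  qed
  moreover have "SOVI1 M F A B \<subseteq> frechet_critical1 F A B"
    if diff: "\<forall>p\<in>A \<times> B. frechet_differentiable1 F p \<and> frechet_differentiable2 F p"
  proof clarify
    fix x y
    assume sol: "(x, y) \<in> SOVI1 M F A B"
    then have p: "(x, y) \<in> A \<times> B"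
      by (auto simp: SOVI1_def)
    have "frechet_derivative (\<lambda>x. F (x, y)) (at x) = (\<lambda>_. 0)"
      by (rule frechet_derivative_at_cone_minimum[OF cone \<open>open A\<close>])
        (use sol bspec[OF diff p] in \<open>auto simp: SOVI1_def frechet_differentiable1_def\<close>)
    then show "(x, y) \<in> frechet_critical1 F A B"
      using bspec[OF diff p] p by (auto simp: frechet_critical1_def frechet_deriv1_def)
  qed
  moreover have "SOVI2 M F A B \<subseteq> gateaux_critical2 F A B"
    if diff: "\<forall>p\<in>A \<times> B. gateaux_differentiable1 F p \<and> gateaux_differentiable2 F p"
  proof clarify
    fix x y
    assume sol: "(x, y) \<in> SOVI2 M F A B"
    then have p: "(x, y) \<in> A \<times> B"
      by (auto simp: SOVI2_def)
    have "(gateaux_quot2 F (x, y) u \<longlongrightarrow> 0) (at 0)" if "u \<noteq> 0" for u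
    proof -
      obtain d where d: "(gateaux_quot2 F (x, y) u \<longlongrightarrow> d) (at 0)"
        using bspec[OF diff p] \<open>u \<noteq> 0\<close> unfolding gateaux_differentiable2_def by blast
      moreover have "d = 0"
        by (rule directional_derivative_at_cone_minimum
              [OF cone \<open>open B\<close>, of y "\<lambda>y. F (x, y)" u])
          (use sol d in \<open>auto simp: SOVI2_def gateaux_quot2_def\<close>)
      ultimately show ?thesis by simp
    qed
    then show "(x, y) \<in> gateaux_critical2 F A B"
      using bspec[OF diff p] p
      by (auto simp: gateaux_critical2_def gateaux_deriv2_def intro!: tendsto_Lim)
  qed
  moreover have "SOVI2 M F A B \<subseteq> frechet_critical2 F A B"
    if diff: "\<forall>p\<in>A \<times> B. frechet_differentiable1 F p \<and> frechet_differentiable2 F p"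
  proof clarify
    fix x y
    assume sol: "(x, y) \<in> SOVI2 M F A B"
    then have p: "(x, y) \<in> A \<times> B"
      by (auto simp: SOVI2_def)
    have "frechet_derivative (\<lambda>y. F (x, y)) (at y) = (\<lambda>_. 0)"
      by (rule frechet_derivative_at_cone_minimum[OF cone \<open>open B\<close>])
        (use sol bspec[OF diff p] in \<open>auto simp: SOVI2_def frechet_differentiable2_def\<close>)
    then show "(x, y) \<in> frechet_critical2 F A B"
      using bspec[OF diff p] p by (auto simp: frechet_critical2_def frechet_deriv2_def)
  qed
  ultimately show ?thesis by blast
qed

end
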